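(* Let $\mathbb{K}$ be an algebraically closed field of characteristic $\neq 2$ and let $L$ be a $3$-dimensional non-Lie $\omega$-Lie algebra over $\mathbb{K}$. Consider the $3$-dimensional $\omega$-Lie algebras with basis $\{x,y,z\}$, bilinear form determined by skew-symmetry and $\omega(x,y)=1$, $\omega(x,z)=\omega(y,z)=0$, and the following brackets: \begin{itemize} \item $A$: $[x,y]=x+y,\ [x,z]=y,\ [y,z]=z$; \item $B$: $[x,y]=z,\ [x,z]=-\tfrac12 x,\ [y,z]=x-\tfrac12 y$; \item $C_\alpha$ (for $\alpha\in\mathbb{K}^\times$): $[x,y]=z,\ [x,z]=\alpha x,\ [y,z]=-(\alpha+1)y$; \item $D$: $[x,y]=y,\ [x,z]=0,\ [y,z]=z$. \end{itemize} Then: (1) $L$ must be isomorphic (as an $\omega$-Lie algebra) to one of $\{A,B,C_\alpha,D\mid\alpha\in\mathbb{K}^\times\}$; (2) all these $\omega$-Lie algebras $A$, $B$, $C_\alpha$ ($\alpha\in\mathbb{K}^\times$) and $D$ are mutually non-isomorphic.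
   Context: An $\omega$-Lie algebra over $\mathbb{K}$ is a triple $(L,[-,-],\omega)$ where $L$ is a finite-dimensional vector space over $\mathbb{K}$, $[-,-]$ is a skew-symmetric bilinear product on $L$, and $\omega:L\times L\to\mathbb{K}$ is a bilinear form such that $[[x,y],z]+[[y,z],x]+[[z,x],y]=\omega(x,y)z+\omega(y,z)x+\omega(z,x)y$ for all $x,y,z\in L$. It is non-Lie if $\omega\neq 0$. $\mathbb{K}^\times$ denotes the set of nonzero elements of $\mathbb{K}$. Two $\omega$-Lie algebras $(L_1,[-,-]_1,\omega_1)$ and $(L_2,[-,-]_2,\omega_2)$ are isomorphic if there is an algebra isomorphism (a linear bijection preserving brackets) $g:L_1\to L_2$ with $\omega_1(x,y)=\omega_2(g(x),g(y))$ for all $x,y\in L_1$.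
   Formalization: In (2), C_α and C_β with α ≠ β are claimed non-isomorphic only when α + β ≠ −1: if α + β = −1, the map x ↦ −y, y ↦ x, z ↦ z is an isomorphism (e.g. C_1 ≅ C_{−2} over the complex numbers), so the claim as stated fails for exactly those pairs. *)

theory Defs
  imports "HOL-Analysis.Analysis" "HOL-Computational_Algebra.Polynomial"
begin

section \<open>Omega-Lie algebras\<close>

text \<open>The underlying vector space is the whole type \<open>'v\<close>, with scalar multiplication \<open>scl\<close>.\<close>

record ('k, 'v) omega_algebra =
  scl :: "'k \<Rightarrow> 'v \<Rightarrow> 'v"
  brk :: "'v \<Rightarrow> 'v \<Rightarrow> 'v"
  omg :: "'v \<Rightarrow> 'v \<Rightarrow> 'k"

text \<open>The form \<open>omg\<close> is only required to be bilinear; its skew-symmetry is not an axiom.\<close>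

definition omega_lie_algebra ::
    "('k::field, 'v::ab_group_add) omega_algebra \<Rightarrow> bool" where
  "omega_lie_algebra L \<longleftrightarrow>
     vector_space (scl L) \<and>
     (\<exists>B. finite B \<and> module.span (scl L) B = UNIV) \<and>
     (\<forall>x. Vector_Spaces.linear (scl L) (scl L) (\<lambda>y. brk L x y)) \<and>
     (\<forall>y. Vector_Spaces.linear (scl L) (scl L) (\<lambda>x. brk L x y)) \<and>
     (\<forall>x y. brk L x y = - brk L y x) \<and>
     (\<forall>x. Vector_Spaces.linear (scl L) (*) (\<lambda>y. omg L x y)) \<and>
     (\<forall>y. Vector_Spaces.linear (scl L) (*) (\<lambda>x. omg L x y)) \<and>
     (\<forall>x y z. brk L (brk L x y) z + brk L (brk L y z) x + brk L (brk L z x) y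
        = scl L (omg L x y) z + scl L (omg L y z) x + scl L (omg L z x) y)"

definition non_Lie :: "('k::field, 'v) omega_algebra \<Rightarrow> bool" where
  "non_Lie L \<longleftrightarrow> omg L \<noteq> (\<lambda>x y. 0)"

definition omega_dim :: "('k::field, 'v::ab_group_add) omega_algebra \<Rightarrow> nat" where
  "omega_dim L = vector_space.dim (scl L) UNIV"

definition omega_isomorphic ::
    "('k::field, 'v::ab_group_add) omega_algebra \<Rightarrow> ('k, 'w::ab_group_add) omega_algebra \<Rightarrow> bool"
    (infix "\<cong>\<^sub>\<omega>" 50) where
  "L1 \<cong>\<^sub>\<omega> L2 \<longleftrightarrow>
     (\<exists>g. Vector_Spaces.linear (scl L1) (scl L2) g \<and> bij g \<and>
          (\<forall>x y. g (brk L1 x y) = brk L2 (g x) (g y)) \<and>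
          (\<forall>x y. omg L1 x y = omg L2 (g x) (g y)))"

section \<open>The four families\<close>

text \<open>The space is \<open>'k ^ 3\<close> and the basis \<open>x, y, z\<close> is the standard one.\<close>

abbreviation ex :: "'k::field ^ 3" where "ex \<equiv> axis 1 1"
abbreviation ey :: "'k::field ^ 3" where "ey \<equiv> axis 2 1"
abbreviation ez :: "'k::field ^ 3" where "ez \<equiv> axis 3 1"

text \<open>\<open>table_algebra p q r\<close> carries the skew-symmetric bilinear bracket determined by
  \<open>[x,y] = p\<close>, \<open>[x,z] = q\<close>, \<open>[y,z] = r\<close>, and the skew-symmetric bilinear form determined by
  \<open>\<omega>(x,y) = 1\<close>, \<open>\<omega>(x,z) = \<omega>(y,z) = 0\<close>; see \<open>table_algebra_basis\<close> below.\<close>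

definition table_algebra ::
    "'k::field ^ 3 \<Rightarrow> 'k ^ 3 \<Rightarrow> 'k ^ 3 \<Rightarrow> ('k, 'k ^ 3) omega_algebra" where
  "table_algebra p q r =
     \<lparr>scl = (*s),
      brk = (\<lambda>u v. (u $ 1 * v $ 2 - u $ 2 * v $ 1) *s p
                 + (u $ 1 * v $ 3 - u $ 3 * v $ 1) *s q
                 + (u $ 2 * v $ 3 - u $ 3 * v $ 2) *s r),
      omg = (\<lambda>u v. u $ 1 * v $ 2 - u $ 2 * v $ 1)\<rparr>"

definition alg_A :: "('k::field, 'k ^ 3) omega_algebra" where
  "alg_A = table_algebra (ex + ey) ey ez"

definition alg_B :: "('k::field, 'k ^ 3) omega_algebra" where
  "alg_B = table_algebra ez (- (1/2) *s ex) (ex - (1/2) *s ey)"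

definition alg_C :: "'k::field \<Rightarrow> ('k, 'k ^ 3) omega_algebra" where
  "alg_C \<alpha> = table_algebra ez (\<alpha> *s ex) (- (\<alpha> + 1) *s ey)"

definition alg_D :: "('k::field, 'k ^ 3) omega_algebra" where
  "alg_D = table_algebra ey 0 ez"

lemma table_algebra_basis:
  fixes p q r :: "'k::field ^ 3"
  defines "T \<equiv> table_algebra p q r"
  shows "brk T ex ey = p" "brk T ex ez = q" "brk T ey ez = r"
    and "brk T u v = - brk T v u"
    and "omg T ex ey = 1" "omg T ex ez = 0" "omg T ey ez = 0"
    and "omg T u v = - omg T v u"
  by (simp_all add: T_def table_algebra_def axis_def vec_eq_iff algebra_simps)

lemma linear_scalar_mult_iff:
  "Vector_Spaces.linear ((*s) :: 'k::field \<Rightarrow> 'k ^ 'n \<Rightarrow> 'k ^ 'n) ((*s) :: 'k \<Rightarrow> 'k ^ 'm \<Rightarrow> 'k ^ 'm) f \<longleftrightarrow>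
     (\<forall>x y. f (x + y) = f x + f y) \<and> (\<forall>c x. f (c *s x) = c *s f x)"
  by (simp add: Vector_Spaces.linear_def module_hom_def module_hom_axioms_def
      vec.vector_space_axioms vec.module_axioms)

lemma linear_scalar_mult_field_iff:
  "Vector_Spaces.linear ((*s) :: 'k::field \<Rightarrow> 'k ^ 'n \<Rightarrow> 'k ^ 'n) ((*) :: 'k \<Rightarrow> 'k \<Rightarrow> 'k) f \<longleftrightarrow>
     (\<forall>x y. f (x + y) = f x + f y) \<and> (\<forall>c x. f (c *s x) = c * f x)"
  by (simp add: Vector_Spaces.linear_def module_hom_def module_hom_axioms_def
      vec.vector_space_axioms vec.module_axioms
      vector_space_over_itself.vector_space_axioms vector_space_over_itself.module_axioms)

lemma omega_dim_table_algebra: "omega_dim (table_algebra p q r) = 3"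
  unfolding omega_dim_def table_algebra_def omega_algebra.simps
  by (subst vec_dim_card) simp

lemma non_Lie_table_algebra: "non_Lie (table_algebra p q r)"
  using table_algebra_basis(5)[of p q r] by (auto simp: non_Lie_def)

lemma omega_lie_table_algebra:
  fixes p q r :: "'k::field ^ 3"
  defines "T \<equiv> table_algebra p q r"
  assumes J: "\<And>u v w. brk T (brk T u v) w + brk T (brk T v w) u + brk T (brk T w u) v
      = omg T u v *s w + omg T v w *s u + omg T w u *s v"
  shows "omega_lie_algebra T"
proof -
  have s: "scl T = (*s)" by (simp add: T_def table_algebra_def)
  have "\<exists>B. finite B \<and> vec.span B = (UNIV :: ('k ^ 3) set)"
    using vec.finite_Basis vec.span_Basis by blast
  then show ?thesis
    using J unfolding omega_lie_algebra_def s linear_scalar_mult_iff linear_scalar_mult_field_iff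
    by (simp add: vec.vector_space_axioms)
       (simp add: T_def table_algebra_def vec_eq_iff algebra_simps)
qed

lemma two_neq_zero:
  assumes "CHAR('k::field) \<noteq> 2"
  shows "(2::'k) \<noteq> 0"
proof
  assume "(2::'k) = 0"
  then have "of_nat 2 = (0::'k)" by simp
  then have "CHAR('k) dvd 2" by (simp only: of_nat_eq_0_iff_char_dvd)
  moreover have "CHAR('k) \<noteq> 1" by simp
  ultimately show False
    using assms by (metis two_is_prime_nat prime_nat_iff)
qed

lemma omega_lie_models:
  fixes \<alpha> :: "'k::field"
  shows "omega_lie_algebra (alg_A :: ('k, 'k ^ 3) omega_algebra)"
    and "CHAR('k) \<noteq> 2 \<Longrightarrow> omega_lie_algebra (alg_B :: ('k, 'k ^ 3) omega_algebra)"
    and "omega_lie_algebra (alg_C \<alpha>)"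
    and "omega_lie_algebra (alg_D :: ('k, 'k ^ 3) omega_algebra)"
proof -
  show "omega_lie_algebra (alg_A :: ('k, 'k ^ 3) omega_algebra)"
    unfolding alg_A_def
    by (rule omega_lie_table_algebra)
       (simp add: table_algebra_def vec_eq_iff forall_3 axis_def, algebra)
  show "omega_lie_algebra (alg_B :: ('k, 'k ^ 3) omega_algebra)" if "CHAR('k) \<noteq> 2"
  proof -
    define h :: 'k where "h = 1 / 2"
    have h: "h + h = 1"
      using two_neq_zero[OF that] by (simp add: h_def flip: mult_2)
    show ?thesis
      unfolding alg_B_def h_def[symmetric]
      apply (rule omega_lie_table_algebra)
      apply (simp add: table_algebra_def vec_eq_iff forall_3 axis_def)
      apply (intro conjI)
      subgoal by algebra
      subgoal by algebra
      subgoal using h apply - by algebra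
      done
  qed
  show "omega_lie_algebra (alg_C \<alpha>)"
    unfolding alg_C_def
    by (rule omega_lie_table_algebra)
       (simp add: table_algebra_def vec_eq_iff forall_3 axis_def, algebra)
  show "omega_lie_algebra (alg_D :: ('k, 'k ^ 3) omega_algebra)"
    unfolding alg_D_def
    by (rule omega_lie_table_algebra)
       (simp add: table_algebra_def vec_eq_iff forall_3 axis_def, algebra)
qed

text \<open>The parameter of the family \<open>alg_C\<close> is not an isomorphism invariant: the substitution
  \<open>x \<mapsto> -y\<close>, \<open>y \<mapsto> x\<close>, \<open>z \<mapsto> z\<close> exchanges \<open>\<alpha>\<close> and \<open>-1 - \<alpha>\<close>. Distinct
  members of the family are therefore claimed to be non-isomorphic only when their parameters
  do not add up to \<open>-1\<close>.\<close>

lemma alg_C_coincidence: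
  fixes \<alpha> \<beta> :: "'k::field"
  assumes "\<alpha> + \<beta> = -1"
  shows "alg_C \<alpha> \<cong>\<^sub>\<omega> alg_C \<beta>"
proof -
  have b: "\<beta> = -1 - \<alpha>" using assms by (simp add: eq_diff_eq add.commute)
  define g :: "'k ^ 3 \<Rightarrow> 'k ^ 3" where "g u = vector [u $ 2, - (u $ 1), u $ 3]" for u
  define g' :: "'k ^ 3 \<Rightarrow> 'k ^ 3" where "g' u = vector [- (u $ 2), u $ 1, u $ 3]" for u
  have "bij g"
    by (rule o_bij[of g']) (auto simp: fun_eq_iff g_def g'_def vec_eq_iff forall_3)
  moreover have "Vector_Spaces.linear (*s) (*s) g"
    unfolding linear_scalar_mult_iff by (simp add: g_def vec_eq_iff forall_3)
  ultimately show ?thesis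
    unfolding omega_isomorphic_def b
    by (intro exI[of _ g])
       (simp add: alg_C_def table_algebra_def g_def vec_eq_iff forall_3 axis_def algebra_simps)
qed

end

theory Submission
  imports Defs
begin

text \<open>
  The form \<open>\<omega>\<close> is alternating, so on a space of dimension three a nonzero \<open>\<omega>\<close> has rank two and
  a one-dimensional radical. With \<open>z\<close> spanning the radical and \<open>\<omega>(x,y) = 1\<close>, the triple \<open>x, y, z\<close> is
  a basis, and \<open>L\<close> becomes an algebra \<open>table_algebra p q r\<close>. The only freedom left is the choice of
  such a triple: a matrix of determinant one acting on \<open>x, y\<close> modulo the radical, a rescaling of \<open>z\<close>,
  and the addition of multiples of \<open>z\<close> to \<open>x\<close> and \<open>y\<close>.

  The main invariant is the \<open>2 \<times> 2\<close> matrix \<open>N\<close> of \<open>u \<mapsto> [u,z]\<close> on the quotient by the radical,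
  given by the first two coordinates of \<open>q = [x,z]\<close> and \<open>r = [y,z]\<close>. An isomorphism changes \<open>N\<close> by
  conjugation and a nonzero scalar factor (\<open>isomorphic_imp_scaled_conjugate\<close>), and every change of
  this kind is realised by an isomorphism (\<open>scaled_conjugate_imp_isomorphic\<close>).

  \<^item> If \<open>N\<close> has nonzero trace, scale it to trace \<open>-1\<close>. It is then either diagonalisable with
    eigenvalues \<open>\<alpha>\<close> and \<open>-(\<alpha> + 1)\<close>, where \<open>\<alpha> \<noteq> 0\<close> can be arranged since not both eigenvalues
    vanish, or a Jordan block with eigenvalue \<open>-1/2\<close>. These cases lead to \<open>C\<^sub>\<alpha>\<close> and \<open>B\<close>.
  \<^item> If \<open>N\<close> has trace zero, the Jacobi identity forces \<open>det N = 0\<close>, so \<open>N\<close> is nilpotent. The case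
    \<open>N \<noteq> 0\<close> leads to \<open>A\<close> and the case \<open>N = 0\<close> to \<open>D\<close>.

  Once \<open>N\<close> is in normal form, the Jacobi identity restricts the remaining structure constants so
  strongly that an explicit basis gives the listed brackets (\<open>isomorphic_alg_A\<close>, \<open>isomorphic_alg_B\<close>,
  \<open>isomorphic_alg_C\<close>, \<open>isomorphic_alg_D\<close>).

  The models are told apart by the same invariant: \<open>N\<close> has trace \<open>-1\<close> for \<open>B\<close> and \<open>C\<^sub>\<alpha>\<close>, is nonzero
  nilpotent for \<open>A\<close>, and is zero for \<open>D\<close>. Between two algebras of trace \<open>-1\<close> the scalar factor must be
  \<open>1\<close>, so the determinant is an invariant. It is \<open>-\<alpha>(\<alpha> + 1)\<close> for \<open>C\<^sub>\<alpha>\<close>, which determines \<open>\<alpha>\<close> up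
  to the exchange of \<open>\<alpha>\<close> and \<open>-1 - \<alpha>\<close>. Only \<open>\<alpha> = -1/2\<close> gives the determinant of \<open>B\<close>, and there
  \<open>N\<close> is scalar for \<open>C\<^sub>\<alpha>\<close> but not for \<open>B\<close>.
\<close>

section \<open>Isomorphisms and bases adapted to the form\<close>

lemma linear_iff_add_scale:
  "Vector_Spaces.linear s1 s2 f \<longleftrightarrow> vector_space s1 \<and> vector_space s2 \<and>
     (\<forall>x y. f (x + y) = f x + f y) \<and> (\<forall>c x. f (s1 c x) = s2 c (f x))"
  unfolding Vector_Spaces.linear_def module_hom_def module_hom_axioms_def
  by (auto simp: module_iff_vector_space)

lemma omega_isomorphic_sym:
  assumes "L \<cong>\<^sub>\<omega> M"
  shows "M \<cong>\<^sub>\<omega> L"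
proof -
  obtain g where g: "Vector_Spaces.linear (scl L) (scl M) g" "bij g"
    "\<And>x y. g (brk L x y) = brk M (g x) (g y)" "\<And>x y. omg L x y = omg M (g x) (g y)"
    using assms unfolding omega_isomorphic_def by blast
  have gi: "g (inv g u) = u" for u
    using g(2) by (simp add: bij_is_surj surj_f_inv_f)
  have ig: "u = inv g v \<longleftrightarrow> g u = v" for u v
    using g(2) gi by (metis bij_inv_eq_iff)
  show ?thesis
    unfolding omega_isomorphic_def
  proof (intro exI[of _ "inv g"] conjI allI)
    show "Vector_Spaces.linear (scl M) (scl L) (inv g)"
      using g(1) unfolding linear_iff_add_scale by (metis gi ig)
    show "bij (inv g)" using g(2) by (rule bij_imp_bij_inv)
    show "inv g (brk M x y) = brk L (inv g x) (inv g y)" for x y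
      by (metis gi ig g(3))
    show "omg M x y = omg L (inv g x) (inv g y)" for x y
      by (simp add: gi g(4))
  qed
qed

lemma omega_isomorphic_trans:
  assumes "L \<cong>\<^sub>\<omega> M" "M \<cong>\<^sub>\<omega> N"
  shows "L \<cong>\<^sub>\<omega> N"
proof -
  obtain g where g: "Vector_Spaces.linear (scl L) (scl M) g" "bij g"
    "\<And>x y. g (brk L x y) = brk M (g x) (g y)" "\<And>x y. omg L x y = omg M (g x) (g y)"
    using assms(1) unfolding omega_isomorphic_def by blast
  obtain h where h: "Vector_Spaces.linear (scl M) (scl N) h" "bij h"
    "\<And>x y. h (brk M x y) = brk N (h x) (h y)" "\<And>x y. omg M x y = omg N (h x) (h y)"
    using assms(2) unfolding omega_isomorphic_def by blast
  show ?thesis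
    unfolding omega_isomorphic_def
  proof (intro exI[of _ "h \<circ> g"] conjI allI)
    show "Vector_Spaces.linear (scl L) (scl N) (h \<circ> g)"
      using g(1) h(1) unfolding linear_iff_add_scale by simp
    show "bij (h \<circ> g)" using g(2) h(2) by (rule bij_comp)
  qed (simp_all only: g(3,4) h(3,4) comp_apply)
qed

lemma omega_lie_algebraD:
  assumes "omega_lie_algebra L"
  shows "vector_space (scl L)"
    and "\<exists>B. finite B \<and> module.span (scl L) B = UNIV"
    and "brk L x (y + z) = brk L x y + brk L x z"
    and "brk L (x + y) z = brk L x z + brk L y z"
    and "brk L x (scl L c y) = scl L c (brk L x y)"
    and "brk L (scl L c x) y = scl L c (brk L x y)"
    and "brk L x y = - brk L y x"
    and "omg L x (y + z) = omg L x y + omg L x z"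
    and "omg L (x + y) z = omg L x z + omg L y z"
    and "omg L x (scl L c y) = c * omg L x y"
    and "omg L (scl L c x) y = c * omg L x y"
    and "brk L (brk L x y) z + brk L (brk L y z) x + brk L (brk L z x) y
        = scl L (omg L x y) z + scl L (omg L y z) x + scl L (omg L z x) y"
  using assms unfolding omega_lie_algebra_def linear_iff_add_scale by metis+

lemma omega_lie_brk_self:
  fixes L :: "('k::field, 'v::ab_group_add) omega_algebra"
  assumes "CHAR('k) \<noteq> 2" "omega_lie_algebra L"
  shows "brk L x x = 0"
proof -
  interpret vector_space "scl L" using assms(2) by (rule omega_lie_algebraD)
  have "brk L x x + brk L x x = 0"
    using omega_lie_algebraD(7)[OF assms(2), of x x] by (simp add: eq_neg_iff_add_eq_0)
  then have "scl L 2 (brk L x x) = 0"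
    using scale_left_distrib[of 1 1 "brk L x x"] by simp
  then show ?thesis using two_neq_zero[OF assms(1)] by simp
qed

text \<open>The form is not assumed skew-symmetric; this comes from the Jacobi identity. At \<open>x, x, z\<close> the
  left side vanishes and the right side is \<open>\<omega>(x,x) z\<close> plus a multiple of \<open>x\<close>. A second dimension
  provides a \<open>z\<close> that is independent of \<open>x\<close>.\<close>

lemma omega_lie_omg_self:
  fixes L :: "('k::field, 'v::ab_group_add) omega_algebra"
  assumes "CHAR('k) \<noteq> 2" "omega_lie_algebra L" "omega_dim L > 1"
  shows "omg L x x = 0"
proof (cases "x = 0")
  case True
  interpret vector_space "scl L" using assms(2) by (rule omega_lie_algebraD)
  show ?thesis
    using True omega_lie_algebraD(11)[OF assms(2), of 0 x x] by simp
next
  case False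
  interpret vector_space "scl L" using assms(2) by (rule omega_lie_algebraD)
  have "span {x} \<noteq> UNIV"
  proof
    assume "span {x} = UNIV"
    then have "dim UNIV \<le> card {x}" by (intro dim_le_card) auto
    then show False using assms(3) by (simp add: omega_dim_def)
  qed
  then obtain z where z: "z \<notin> span {x}" by blast
  have "brk L (brk L x z) x = - brk L (brk L z x) x"
  proof -
    have "brk L x z = scl L (- 1) (brk L z x)"
      using omega_lie_algebraD(7)[OF assms(2), of x z] by simp
    then show ?thesis
      using omega_lie_algebraD(6)[OF assms(2), of "- 1" "brk L z x" x] by simp
  qed
  moreover have "brk L (brk L x x) z = 0"
    using omega_lie_algebraD(6)[OF assms(2), of 0 0 z] omega_lie_brk_self[OF assms(1,2)]
    by simp
  ultimately have "scl L (omg L x x) z + scl L (omg L x z + omg L z x) x = 0"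
    using omega_lie_algebraD(12)[OF assms(2), of x x z]
    by (simp add: scale_left_distrib add.assoc)
  then have "scl L (omg L x x) z = scl L (- (omg L x z + omg L z x)) x"
    by (simp only: add_eq_0_iff2 scale_minus_left)
  then have *: "scl L (omg L x x) z \<in> span {x}"
    by (simp add: span_scale span_base del: scale_minus_left)
  show ?thesis
  proof (rule ccontr)
    assume "omg L x x \<noteq> 0"
    then have "z = scl L (inverse (omg L x x)) (scl L (omg L x x) z)" by simp
    then show False using z span_scale[OF *] by metis
  qed
qed

lemma omega_lie_omg_skew:
  fixes L :: "('k::field, 'v::ab_group_add) omega_algebra"
  assumes "CHAR('k) \<noteq> 2" "omega_lie_algebra L" "omega_dim L > 1"
  shows "omg L x y = - omg L y x"
proof -
  have "0 = omg L (x + y) (x + y)" by (simp add: omega_lie_omg_self[OF assms])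
  also have "\<dots> = omg L x x + omg L y x + (omg L x y + omg L y y)"
    by (simp only: omega_lie_algebraD(8,9)[OF assms(2)])
  also have "\<dots> = omg L x y + omg L y x"
    by (simp add: omega_lie_omg_self[OF assms] add.commute)
  finally show ?thesis by (simp add: eq_neg_iff_add_eq_0)
qed

lemma table_algebra_simps [simp]:
  "scl (table_algebra p q r) = (*s)"
  "omg (table_algebra p q r) u v = u $ 1 * v $ 2 - u $ 2 * v $ 1"
  by (simp_all add: table_algebra_def)

lemma brk_table_nth:
  "brk (table_algebra p q r) u v $ i = (u $ 1 * v $ 2 - u $ 2 * v $ 1) * p $ i
    + (u $ 1 * v $ 3 - u $ 3 * v $ 1) * q $ i + (u $ 2 * v $ 3 - u $ 3 * v $ 2) * r $ i"
  by (simp add: table_algebra_def ring_distribs)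

text \<open>
  Here \<open>z\<close> spans the radical of \<open>\<omega>\<close>. Linear independence of the triple is a consequence, which is
  what makes the condition easy to verify for a new triple.
\<close>

definition frame :: "('k::field, 'v::ab_group_add) omega_algebra \<Rightarrow> 'v \<Rightarrow> 'v \<Rightarrow> 'v \<Rightarrow> bool" where
  "frame L x y z \<longleftrightarrow> omg L x y = 1 \<and> omg L x z = 0 \<and> omg L y z = 0 \<and> z \<noteq> 0"

text \<open>Pairing a linear relation \<open>a x + b y + c z = 0\<close> with \<open>x\<close> and \<open>y\<close> under \<open>\<omega>\<close> gives \<open>b = 0\<close> and
  \<open>a = 0\<close>, and then \<open>c = 0\<close> because \<open>z \<noteq> 0\<close>. Three independent vectors span a space of dimension
  three.\<close>

lemma frame_decompose:
  fixes L :: "('k::field, 'v::ab_group_add) omega_algebra"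
  assumes char: "CHAR('k) \<noteq> 2" and L: "omega_lie_algebra L" and dim: "omega_dim L = 3"
    and fr: "frame L x y z"
  shows "\<exists>!u :: 'k ^ 3. v = scl L (u $ 1) x + scl L (u $ 2) y + scl L (u $ 3) z"
proof -
  interpret vector_space "scl L" using L by (rule omega_lie_algebraD)
  note D = omega_lie_algebraD[OF L]
  have dim1: "omega_dim L > 1" using dim by simp
  note self = omega_lie_omg_self[OF char L dim1] and skew = omega_lie_omg_skew[OF char L dim1]
  have zero: "a = 0 \<and> b = 0 \<and> c = 0" if e: "scl L a x + scl L b y + scl L c z = 0" for a b c
  proof -
    have o: "omg L t (scl L a x + scl L b y + scl L c z) = 0" for t
      using D(10)[of t 0 0] by (simp add: e)
    have ab: "a = 0" "b = 0"
      using o[of x] o[of y] fr skew[of y x] by (simp_all add: D(8,10) self frame_def)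
    then show ?thesis using e fr by (simp add: frame_def)
  qed
  have uniq: "a = a' \<and> b = b' \<and> c = c'"
    if "scl L a x + scl L b y + scl L c z = scl L a' x + scl L b' y + scl L c' z"
    for a b c a' b' c'
    using zero[of "a - a'" "b - b'" "c - c'"] that
    by (simp add: scale_left_diff_distrib algebra_simps)
  have z0: "z \<noteq> 0" using fr by (simp add: frame_def)
  have y1: "y \<notin> span {z}"
  proof
    assume "y \<in> span {z}"
    then obtain c where "y = scl L c z" by (auto simp: span_singleton)
    then show False using zero[of 0 1 "- c"] by simp
  qed
  have x1: "x \<notin> span {y, z}"
  proof
    assume "x \<in> span {y, z}"
    then obtain b where "x - scl L b y \<in> span {z}" by (auto simp: span_insert[of y])
    then obtain c where "x - scl L b y = scl L c z" by (auto simp: span_singleton)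
    then show False using zero[of 1 "- b" "- c"] by (simp add: algebra_simps)
  qed
  have ind: "independent {x, y, z}"
    using z0 y1 x1 by (simp add: independent_insert dependent_single span_base)
  have card: "card {x, y, z} = 3"
  proof -
    have "y \<noteq> z" using y1 by (auto simp: span_base)
    moreover have "x \<notin> {y, z}" using x1 span_base by blast
    ultimately show ?thesis by simp
  qed
  obtain B where B: "finite B" "span B = UNIV" using D(2) by blast
  have "v \<in> span {x, y, z}"
  proof (rule ccontr)
    assume v: "v \<notin> span {x, y, z}"
    then have v': "v \<notin> {x, y, z}" by (metis span_base)
    have i: "independent (insert v {x, y, z})"
      using v ind by (rule independent_insertI)
    let ?E = "extend_basis (insert v {x, y, z})"
    note E = independent_extend_basis[OF i] span_extend_basis[OF i] extend_basis_superset[OF i]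
    have fin: "finite ?E" using independent_span_bound[of B ?E] B E(1) by simp
    have "card ?E = 3"
      using basis_card_eq_dim[OF subset_UNIV _ E(1)] E(2) dim by (simp add: omega_dim_def)
    moreover have "card (insert v {x, y, z}) = 4"
      using v' card by (subst card_insert_disjoint) auto
    ultimately show False using card_mono[OF fin E(3)] by simp
  qed
  then obtain a where "v - scl L a x \<in> span {y, z}" by (auto simp: span_insert[of x])
  then obtain b where "v - scl L a x - scl L b y \<in> span {z}" by (auto simp: span_insert[of y])
  then obtain c where "v - scl L a x - scl L b y = scl L c z" by (auto simp: span_singleton)
  then have v: "v = scl L a x + scl L b y + scl L c z" by (simp add: algebra_simps)
  show ?thesis
  proof (rule ex1I)
    show "v = scl L ((vector [a, b, c] :: 'k ^ 3) $ 1) x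
        + scl L ((vector [a, b, c] :: 'k ^ 3) $ 2) y + scl L ((vector [a, b, c] :: 'k ^ 3) $ 3) z"
      using v by simp
    show "u = vector [a, b, c]"
      if "v = scl L (u $ 1) x + scl L (u $ 2) y + scl L (u $ 3) z" for u :: "'k ^ 3"
      using uniq[of "u $ 1" "u $ 2" "u $ 3" a b c] that v by (simp add: vec_eq_iff forall_3)
  qed
qed

text \<open>The structure constants in a frame determine the algebra. This is the source of every
  isomorphism in the classification: both the passage from an abstract algebra to a table and each
  later simplification of a table are choices of a frame.\<close>

lemma isomorphic_table_algebra:
  fixes L :: "('k::field, 'v::ab_group_add) omega_algebra" and p q r :: "'k ^ 3"
  assumes char: "CHAR('k) \<noteq> 2" and L: "omega_lie_algebra L" and dim: "omega_dim L = 3"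
    and fr: "frame L x y z"
    and p: "brk L x y = scl L (p $ 1) x + scl L (p $ 2) y + scl L (p $ 3) z"
    and q: "brk L x z = scl L (q $ 1) x + scl L (q $ 2) y + scl L (q $ 3) z"
    and r: "brk L y z = scl L (r $ 1) x + scl L (r $ 2) y + scl L (r $ 3) z"
  shows "L \<cong>\<^sub>\<omega> table_algebra p q r"
proof (rule omega_isomorphic_sym)
  interpret vector_space "scl L" using L by (rule omega_lie_algebraD)
  note D = omega_lie_algebraD[OF L]
  have dim1: "omega_dim L > 1" using dim by simp
  note self = omega_lie_omg_self[OF char L dim1] and skew = omega_lie_omg_skew[OF char L dim1]
  note bself = omega_lie_brk_self[OF char L]
  define g :: "'k ^ 3 \<Rightarrow> 'v" where "g u = scl L (u $ 1) x + scl L (u $ 2) y + scl L (u $ 3) z" for u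
  have b: "brk L y x = - brk L x y" "brk L z x = - brk L x z" "brk L z y = - brk L y z"
    by (rule D(7))+
  have o: "omg L x y = 1" "omg L x z = 0" "omg L y z = 0" "omg L y x = - 1" "omg L z x = 0" "omg L z y = 0"
    using fr skew[of y x] skew[of z x] skew[of z y] by (simp_all add: frame_def)
  have lin: "g (c *s u) = scl L c (g u)" "g (u + v) = g u + g v" for c u v
    by (simp_all add: g_def scale_right_distrib scale_left_distrib algebra_simps)
  have "brk L (g u) (g v) = scl L (u $ 1 * v $ 2 - u $ 2 * v $ 1) (brk L x y)
        + scl L (u $ 1 * v $ 3 - u $ 3 * v $ 1) (brk L x z)
        + scl L (u $ 2 * v $ 3 - u $ 3 * v $ 2) (brk L y z)" for u v
    by (simp add: g_def D(3-6) bself b scale_left_diff_distrib algebra_simps)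
  moreover have "brk L x y = g p" "brk L x z = g q" "brk L y z = g r"
    using p q r by (simp_all add: g_def)
  ultimately have brk: "g (brk (table_algebra p q r) u v) = brk L (g u) (g v)" for u v
    by (simp only: table_algebra_def omega_algebra.select_convs lin)
  have omg: "omg L (g u) (g v) = u $ 1 * v $ 2 - u $ 2 * v $ 1" for u v
    by (simp add: g_def D(8-11) self o algebra_simps)
  have "bij g"
    unfolding bij_iff g_def using frame_decompose[OF char L dim fr] by metis
  then show "table_algebra p q r \<cong>\<^sub>\<omega> L"
    unfolding omega_isomorphic_def linear_iff_add_scale
    by (intro exI[of _ g]) (simp add: brk omg lin vec.vector_space_axioms vector_space_axioms)
qed

text \<open>Take \<open>x, y\<close> with \<open>\<omega>(x,y) = 1\<close> and a vector \<open>w\<close> outside their span. Subtracting from \<open>w\<close> its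
  projection along \<open>\<omega>\<close> onto the span of \<open>x, y\<close> leaves a nonzero vector of the radical.\<close>

lemma frame_exists:
  fixes L :: "('k::field, 'v::ab_group_add) omega_algebra"
  assumes char: "CHAR('k) \<noteq> 2" and L: "omega_lie_algebra L" and "non_Lie L"
    and dim: "omega_dim L = 3"
  shows "\<exists>x y z. frame L x y z"
proof -
  interpret vector_space "scl L" using L by (rule omega_lie_algebraD)
  note D = omega_lie_algebraD[OF L]
  have dim1: "omega_dim L > 1" using dim by simp
  note self = omega_lie_omg_self[OF char L dim1] and skew = omega_lie_omg_skew[OF char L dim1]
  obtain x t where xt: "omg L x t \<noteq> 0" using assms(3) unfolding non_Lie_def by blast
  define y where "y = scl L (inverse (omg L x t)) t"
  have xy: "omg L x y = 1" using xt by (simp add: y_def D)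
  have "span {x, y} \<noteq> UNIV"
  proof
    assume "span {x, y} = UNIV"
    then have "dim UNIV \<le> card {x, y}" by (intro dim_le_card) auto
    also have "\<dots> \<le> 2" by (simp add: card_insert_if)
    finally show False using dim by (simp add: omega_dim_def)
  qed
  then obtain w where w: "w \<notin> span {x, y}" by blast
  \<comment> \<open>The projection: \<open>s\<close> pairs with \<open>x\<close> and with \<open>y\<close> exactly as \<open>w\<close> does.\<close>
  define s where "s = scl L (- omg L y w) x + scl L (omg L x w) y"
  have "s \<in> span {x, y}"
    unfolding s_def by (intro span_add span_scale span_base) auto
  then have "w + scl L (- 1) s \<noteq> 0" using w by auto
  moreover have "omg L x (w + scl L (- 1) s) = 0" "omg L y (w + scl L (- 1) s) = 0"
    using xy skew[of y x] by (simp_all only: D s_def self) simp_all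
  ultimately have "frame L x y (w + scl L (- 1) s)" using xy by (simp add: frame_def)
  then show ?thesis by blast
qed

lemma exists_isomorphic_table_algebra:
  fixes L :: "('k::field, 'v::ab_group_add) omega_algebra"
  assumes "CHAR('k) \<noteq> 2" "omega_lie_algebra L" "non_Lie L" "omega_dim L = 3"
  shows "\<exists>p q r :: 'k ^ 3. L \<cong>\<^sub>\<omega> table_algebra p q r"
proof -
  obtain x y z where fr: "frame L x y z" using frame_exists[OF assms] by blast
  note coord = ex1_implies_ex[OF frame_decompose[OF assms(1,2,4) fr]]
  obtain p :: "'k ^ 3" where p: "brk L x y = scl L (p $ 1) x + scl L (p $ 2) y + scl L (p $ 3) z"
    using coord[of "brk L x y"] by (elim exE)
  obtain q :: "'k ^ 3" where q: "brk L x z = scl L (q $ 1) x + scl L (q $ 2) y + scl L (q $ 3) z"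
    using coord[of "brk L x z"] by (elim exE)
  obtain r :: "'k ^ 3" where r: "brk L y z = scl L (r $ 1) x + scl L (r $ 2) y + scl L (r $ 3) z"
    using coord[of "brk L y z"] by (elim exE)
  show ?thesis using isomorphic_table_algebra[OF assms(1,2,4) fr p q r] by blast
qed

lemma omega_lie_isomorphic_table_algebra:
  fixes L :: "('k::field, 'v::ab_group_add) omega_algebra" and p q r :: "'k ^ 3"
  assumes L: "omega_lie_algebra L" and iso: "L \<cong>\<^sub>\<omega> table_algebra p q r"
  shows "omega_lie_algebra (table_algebra p q r)"
proof (rule omega_lie_table_algebra)
  let ?T = "table_algebra p q r"
  obtain g where g: "Vector_Spaces.linear (scl L) (scl ?T) g" "bij g"
    "\<And>x y. g (brk L x y) = brk ?T (g x) (g y)" "\<And>x y. omg L x y = omg ?T (g x) (g y)"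
    using iso unfolding omega_isomorphic_def by blast
  have lin: "g (a + b) = g a + g b" "g (scl L c a) = c *s g a" for a b c
    using g(1) by (simp_all add: linear_iff_add_scale)
  fix u v w
  obtain x y z where xyz: "u = g x" "v = g y" "w = g z"
    using bij_is_surj[OF g(2)] by (metis surj_def)
  show "brk ?T (brk ?T u v) w + brk ?T (brk ?T v w) u + brk ?T (brk ?T w u) v
      = omg ?T u v *s w + omg ?T v w *s u + omg ?T w u *s v"
    unfolding xyz
    using arg_cong[OF omega_lie_algebraD(12)[OF L, of x y z], of g]
    by (simp only: lin g(3) g(4))
qed

text \<open>In dimension three the Jacobi identity is alternating, so its content is the single instance at
  the basis \<open>x, y, z\<close>. The first two equations say that a certain combination of the rows of \<open>N\<close> equals
  \<open>tr N\<close> times the first two coordinates of \<open>[x,y]\<close>; the \<open>1\<close> in the third is \<open>\<omega>(x,y)\<close>.\<close>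

lemma table_algebra_jacobi:
  fixes p q r :: "'k::field ^ 3"
  assumes "omega_lie_algebra (table_algebra p q r)"
  shows "(p $ 1 - r $ 3) * q $ 1 + (p $ 2 + q $ 3) * r $ 1 = (q $ 1 + r $ 2) * p $ 1"
    and "(p $ 1 - r $ 3) * q $ 2 + (p $ 2 + q $ 3) * r $ 2 = (q $ 1 + r $ 2) * p $ 2"
    and "(p $ 1 - r $ 3) * q $ 3 + (p $ 2 + q $ 3) * r $ 3 = (q $ 1 + r $ 2) * p $ 3 + 1"
  using omega_lie_algebraD(12)[OF assms, of ex ey ez]
  by (simp_all add: vec_eq_iff forall_3 brk_table_nth axis_def algebra_simps)

text \<open>The three conditions on \<open>z\<close> say that it spans the radical, which is the third coordinate axis for
  every table.\<close>

lemma table_algebra_change_basis: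
  fixes p q r x y z :: "'k::field ^ 3"
  assumes "CHAR('k) \<noteq> 2" "omega_lie_algebra (table_algebra p q r)"
    and "x $ 1 * y $ 2 - x $ 2 * y $ 1 = 1" "z $ 1 = 0" "z $ 2 = 0" "z $ 3 \<noteq> 0"
    and "brk (table_algebra p q r) x y = p' $ 1 *s x + p' $ 2 *s y + p' $ 3 *s z"
    and "brk (table_algebra p q r) x z = q' $ 1 *s x + q' $ 2 *s y + q' $ 3 *s z"
    and "brk (table_algebra p q r) y z = r' $ 1 *s x + r' $ 2 *s y + r' $ 3 *s z"
  shows "table_algebra p q r \<cong>\<^sub>\<omega> table_algebra p' q' r'"
proof (rule isomorphic_table_algebra[OF assms(1,2) omega_dim_table_algebra])
  show "frame (table_algebra p q r) x y z"
    using assms(3-6) by (auto simp: frame_def)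
qed (use assms(7-9) in simp_all)

section \<open>The action of the radical on the quotient\<close>

text \<open>The matrices \<open>N\<close> with rows \<open>(a, b), (c, d)\<close> and \<open>N'\<close> with rows \<open>(a', b'), (c', d')\<close> act on row
  vectors from the right, matching \<open>[x,z] = a x + b y\<close> and \<open>[y,z] = c x + d y\<close> modulo the radical.
  The relation is \<open>k P N = N' P\<close> for a matrix \<open>P\<close> of determinant one with rows \<open>x, y\<close>: the new basis
  preserves \<open>\<omega>\<close>, and \<open>k\<close> is the factor by which \<open>z\<close> is rescaled.\<close>

definition scaled_conjugate ::
    "'k::field \<Rightarrow> 'k \<Rightarrow> 'k \<Rightarrow> 'k \<Rightarrow> 'k \<Rightarrow> 'k \<Rightarrow> 'k \<Rightarrow> 'k \<Rightarrow> bool" where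
  "scaled_conjugate a b c d a' b' c' d' \<longleftrightarrow>
     (\<exists>k x1 x2 y1 y2. k \<noteq> 0 \<and> x1 * y2 - x2 * y1 = 1 \<and>
        k * (x1 * a + x2 * c) = a' * x1 + b' * y1 \<and> k * (x1 * b + x2 * d) = a' * x2 + b' * y2 \<and>
        k * (y1 * a + y2 * c) = c' * x1 + d' * y1 \<and> k * (y1 * b + y2 * d) = c' * x2 + d' * y2)"

lemma scaled_conjugate_scale:
  assumes "scaled_conjugate (k * a) (k * b) (k * c) (k * d) a' b' c' d'" "k \<noteq> 0"
  shows "scaled_conjugate a b c d a' b' c' d'"
proof -
  obtain l x1 x2 y1 y2 where "l \<noteq> 0" "x1 * y2 - x2 * y1 = 1"
     "l * (x1 * (k * a) + x2 * (k * c)) = a' * x1 + b' * y1" "l * (x1 * (k * b) + x2 * (k * d)) = a' * x2 + b' * y2"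
     "l * (y1 * (k * a) + y2 * (k * c)) = c' * x1 + d' * y1" "l * (y1 * (k * b) + y2 * (k * d)) = c' * x2 + d' * y2"
    using assms(1) unfolding scaled_conjugate_def by blast
  then show ?thesis
    unfolding scaled_conjugate_def using assms(2)
    by (intro exI[of _ "l * k"] exI[of _ x1] exI[of _ x2] exI[of _ y1] exI[of _ y2])
       (simp add: algebra_simps)
qed

text \<open>Since \<open>N' = k P N P\<inverse>\<close>, the trace is multiplied by \<open>k\<close>, the determinant by \<open>k\<^sup>2\<close>, and a
  scalar matrix stays scalar, so its off-diagonal entries remain zero.\<close>

lemma scaled_conjugate_invariants:
  assumes "scaled_conjugate a b c d a' b' c' d'"
  shows "\<exists>k. k \<noteq> 0 \<and> a' + d' = k * (a + d) \<and> a' * d' - b' * c' = k\<^sup>2 * (a * d - b * c)"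
    and "b = 0 \<Longrightarrow> c = 0 \<Longrightarrow> a = d \<Longrightarrow> b' = 0 \<and> c' = 0"
proof -
  obtain k x1 x2 y1 y2 where k: "k \<noteq> 0" and *: "x1 * y2 - x2 * y1 = 1"
      "k * (x1 * a + x2 * c) = a' * x1 + b' * y1" "k * (x1 * b + x2 * d) = a' * x2 + b' * y2"
      "k * (y1 * a + y2 * c) = c' * x1 + d' * y1" "k * (y1 * b + y2 * d) = c' * x2 + d' * y2"
    using assms unfolding scaled_conjugate_def by blast
  \<comment> \<open>The entries of \<open>k P N P\<inverse>\<close>, where the inverse of \<open>P\<close> is its adjugate.\<close>
  have e: "a' = k * ((x1 * a + x2 * c) * y2 - (x1 * b + x2 * d) * y1)"
    "b' = k * ((x1 * b + x2 * d) * x1 - (x1 * a + x2 * c) * x2)"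
    "c' = k * ((y1 * a + y2 * c) * y2 - (y1 * b + y2 * d) * y1)"
    "d' = k * ((y1 * b + y2 * d) * x1 - (y1 * a + y2 * c) * x2)"
    using * by algebra+
  have "a' + d' = k * (a + d)" "a' * d' - b' * c' = k\<^sup>2 * (a * d - b * c)"
    unfolding e using *(1) by algebra+
  with k show "\<exists>k. k \<noteq> 0 \<and> a' + d' = k * (a + d) \<and> a' * d' - b' * c' = k\<^sup>2 * (a * d - b * c)"
    by blast
  show "b' = 0 \<and> c' = 0" if "b = 0" "c = 0" "a = d"
    unfolding e using that by (simp add: algebra_simps)
qed

text \<open>An isomorphism preserves \<open>\<omega>\<close>, hence maps the radical to the radical and induces a map of
  determinant one on the quotient. Comparing the brackets with \<open>z\<close> modulo the radical gives the
  claim, with \<open>k\<close> the factor by which the isomorphism scales the third axis. The roles of the two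
  matrices are exchanged because the images of the basis form a basis of the target.\<close>

lemma isomorphic_imp_scaled_conjugate:
  fixes p q r p' q' r' :: "'k::field ^ 3"
  assumes "table_algebra p q r \<cong>\<^sub>\<omega> table_algebra p' q' r'"
  shows "scaled_conjugate (q' $ 1) (q' $ 2) (r' $ 1) (r' $ 2) (q $ 1) (q $ 2) (r $ 1) (r $ 2)"
proof -
  let ?T = "table_algebra p q r" and ?T' = "table_algebra p' q' r'"
  obtain g where g: "Vector_Spaces.linear (*s) (*s) g" "bij g"
    "\<And>x y. g (brk ?T x y) = brk ?T' (g x) (g y)" "\<And>x y. omg ?T x y = omg ?T' (g x) (g y)"
    using assms unfolding omega_isomorphic_def table_algebra_simps(1) by blast
  have lin: "g (a + b) = g a + g b" "g (c *s a) = c *s g a" for a b c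
    using g(1) by (simp_all add: linear_scalar_mult_iff)
  have gv: "g v = v $ 1 *s g ex + v $ 2 *s g ey + v $ 3 *s g ez" for v
  proof -
    have "v = v $ 1 *s ex + v $ 2 *s ey + v $ 3 *s ez"
      by (simp add: vec_eq_iff forall_3 axis_def)
    then show ?thesis by (metis lin)
  qed
  define x where "x = g ex" define y where "y = g ey" define z where "z = g ez"
  have xy: "x $ 1 * y $ 2 - x $ 2 * y $ 1 = 1"
    using g(4)[of ex ey] by (simp add: x_def y_def axis_def)
  have xz: "x $ 1 * z $ 2 - x $ 2 * z $ 1 = 0" and yz: "y $ 1 * z $ 2 - y $ 2 * z $ 1 = 0"
    using g(4)[of ex ez] g(4)[of ey ez] by (simp_all add: x_def y_def z_def axis_def)
  have z: "z $ 1 = 0" "z $ 2 = 0"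
    using xy xz yz by algebra+
  have "z \<noteq> 0"
  proof
    assume "z = 0"
    then have "g ez = g 0" using lin(2)[of 0 0] by (simp add: z_def)
    then have "(ez :: 'k ^ 3) = 0" using g(2) by (metis bij_pointE)
    then show False by simp
  qed
  then have z3: "z $ 3 \<noteq> 0" using z by (auto simp: vec_eq_iff forall_3)
  have "brk ?T' x z = g q" "brk ?T' y z = g r"
    using g(3)[of ex ez] g(3)[of ey ez] table_algebra_basis(2,3)[of p q r]
    by (simp_all add: x_def y_def z_def)
  then have "brk ?T' x z $ i = q $ 1 * x $ i + q $ 2 * y $ i + q $ 3 * z $ i"
    "brk ?T' y z $ i = r $ 1 * x $ i + r $ 2 * y $ i + r $ 3 * z $ i" for i
    using gv[of q] gv[of r] by (simp_all add: x_def y_def z_def)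
  from this[of 1] this[of 2] show ?thesis
    unfolding scaled_conjugate_def using xy z z3
    by (intro exI[of _ "z $ 3"] exI[of _ "x $ 1"] exI[of _ "x $ 2"] exI[of _ "y $ 1"] exI[of _ "y $ 2"])
       (simp add: brk_table_nth algebra_simps)
qed

text \<open>The converse: the new frame has no \<open>z\<close>-component in \<open>x\<close> and \<open>y\<close>. Since its determinant is one,
  \<open>[x,y]\<close> is still the vector \<open>p\<close>, and Cramer's rule gives its new coordinates.\<close>

lemma scaled_conjugate_imp_isomorphic:
  fixes p q r :: "'k::field ^ 3"
  assumes char: "CHAR('k) \<noteq> 2" and T: "omega_lie_algebra (table_algebra p q r)"
    and "scaled_conjugate (q $ 1) (q $ 2) (r $ 1) (r $ 2) a b c d"
  shows "\<exists>p' q' r' :: 'k ^ 3. table_algebra p q r \<cong>\<^sub>\<omega> table_algebra p' q' r' \<and>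
    q' $ 1 = a \<and> q' $ 2 = b \<and> r' $ 1 = c \<and> r' $ 2 = d"
proof -
  obtain k x1 x2 y1 y2 where k: "k \<noteq> 0" and xy: "x1 * y2 - x2 * y1 = 1" and
      *: "k * (x1 * q $ 1 + x2 * r $ 1) = a * x1 + b * y1"
      "k * (x1 * q $ 2 + x2 * r $ 2) = a * x2 + b * y2"
      "k * (y1 * q $ 1 + y2 * r $ 1) = c * x1 + d * y1"
      "k * (y1 * q $ 2 + y2 * r $ 2) = c * x2 + d * y2"
    using assms(3) unfolding scaled_conjugate_def by blast
  define p' :: "'k ^ 3" where
    "p' = vector [p $ 1 * y2 - p $ 2 * y1, x1 * p $ 2 - x2 * p $ 1, p $ 3 / k]"
  define q' :: "'k ^ 3" where "q' = vector [a, b, x1 * q $ 3 + x2 * r $ 3]"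
  define r' :: "'k ^ 3" where "r' = vector [c, d, y1 * q $ 3 + y2 * r $ 3]"
  define x y z :: "'k ^ 3"
    where "x = vector [x1, x2, 0]" and "y = vector [y1, y2, 0]" and "z = vector [0, 0, k]"
  have "table_algebra p q r \<cong>\<^sub>\<omega> table_algebra p' q' r'"
  proof (rule table_algebra_change_basis[OF char T, of x y z])
    show "brk (table_algebra p q r) x y = p' $ 1 *s x + p' $ 2 *s y + p' $ 3 *s z"
      using k xy by (simp add: vec_eq_iff forall_3 brk_table_nth x_def y_def z_def p'_def) algebra
    show "brk (table_algebra p q r) x z = q' $ 1 *s x + q' $ 2 *s y + q' $ 3 *s z"
      using *(1,2)
      by (simp add: vec_eq_iff forall_3 brk_table_nth x_def y_def z_def q'_def algebra_simps)
    show "brk (table_algebra p q r) y z = r' $ 1 *s x + r' $ 2 *s y + r' $ 3 *s z"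
      using *(3,4)
      by (simp add: vec_eq_iff forall_3 brk_table_nth x_def y_def z_def r'_def algebra_simps)
  qed (use xy k in \<open>simp_all add: x_def y_def z_def\<close>)
  moreover have "q' $ 1 = a" "q' $ 2 = b" "r' $ 1 = c" "r' $ 2 = d" by (simp_all add: q'_def r'_def)
  ultimately show ?thesis by blast
qed

text \<open>The expression is \<open>det (v, v N)\<close>. If \<open>N\<close> is not diagonal, one of the two basis vectors is not an
  eigenvector.\<close>

lemma cyclic_vector_exists:
  fixes a b c d :: "'k::field"
  assumes "b \<noteq> 0 \<or> c \<noteq> 0"
  shows "\<exists>v1 v2. v1 * (v1 * b + v2 * d) - v2 * (v1 * a + v2 * c) \<noteq> 0"
proof (cases "b = 0")
  case True
  with assms show ?thesis by (intro exI[of _ 0] exI[of _ 1]) simp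
next
  case False
  then show ?thesis by (intro exI[of _ 1] exI[of _ 0]) simp
qed

text \<open>For a cyclic vector \<open>v\<close> with image \<open>w = v N\<close> and eigenvalues \<open>\<kappa>, \<mu>\<close>, the theorem of Cayley and
  Hamilton makes \<open>w - \<mu> v\<close> an eigenvector for \<open>\<kappa>\<close> and \<open>w - \<kappa> v\<close> one for \<open>\<mu>\<close>. If \<open>\<kappa> = \<mu>\<close>, the pair
  \<open>w - \<kappa> v, v\<close> is a Jordan basis. Algebraic closedness enters twice, for an eigenvalue and for a
  square root: up to multiples of the eigenvector added to the other vector, a Jordan basis can only
  be multiplied by a common factor \<open>i\<close>, which changes its determinant by \<open>i\<^sup>2\<close>. An eigenbasis can be corrected in one vector alone.\<close>

lemma scaled_conjugate_trace_minus_one: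
  fixes a b c d :: "'k::alg_closed_field"
  assumes char: "CHAR('k) \<noteq> 2" and tr: "a + d = - 1"
  shows "(\<exists>\<alpha>. \<alpha> \<noteq> 0 \<and> scaled_conjugate a b c d \<alpha> 0 0 (- (\<alpha> + 1))) \<or>
    scaled_conjugate a b c d (- (1/2)) 0 1 (- (1/2))"
proof -
  have two: "(2::'k) \<noteq> 0" using char by (rule two_neq_zero)
  show ?thesis
  proof (cases "b = 0 \<and> c = 0")
    case True
    have "a = - (d + 1)" "d = - (a + 1)" using tr by algebra+
    \<comment> \<open>The identity and a rotation put either diagonal entry first; not both are zero.\<close>
    have "scaled_conjugate a b c d a 0 0 (- (a + 1))"
      unfolding scaled_conjugate_def using True \<open>d = - (a + 1)\<close>
      by (intro exI[of _ 1] exI[of _ 0]) (auto intro!: exI[of _ 1])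
    moreover have "scaled_conjugate a b c d d 0 0 (- (d + 1))"
      unfolding scaled_conjugate_def using True \<open>a = - (d + 1)\<close>
      by (intro exI[of _ 1] exI[of _ 0] exI[of _ "- 1"]) simp
    moreover have "a \<noteq> 0 \<or> d \<noteq> 0" using tr by auto
    ultimately show ?thesis by blast
  next
    case False
    then obtain v1 v2 where cyc: "v1 * (v1 * b + v2 * d) - v2 * (v1 * a + v2 * c) \<noteq> 0"
      using cyclic_vector_exists[of b c d a] by auto
    define w1 w2 where w: "w1 = v1 * a + v2 * c" "w2 = v1 * b + v2 * d"
    define \<delta> where "\<delta> = v1 * w2 - v2 * w1"
    have \<delta>: "\<delta> \<noteq> 0" using cyc by (simp add: \<delta>_def w)
    define D where "D = a * d - b * c"
    have cayley: "w1 * a + w2 * c = - w1 - D * v1" "w1 * b + w2 * d = - w2 - D * v2"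
      unfolding w D_def using tr by algebra+
    \<comment> \<open>If \<open>0\<close> is an eigenvalue, the other one is \<open>-1\<close>.\<close>
    obtain \<kappa> where root: "\<kappa> * \<kappa> + \<kappa> + D = 0" and nz: "\<kappa> \<noteq> 0"
    proof -
      obtain l where l: "poly [:D, 1, 1:] l = 0"
        using alg_closed_imp_poly_has_root[of "[:D, 1, 1:]"] by auto
      show ?thesis
      proof (cases "l = 0")
        case True
        then show ?thesis using l that[of "- 1"] by simp
      next
        case False
        then show ?thesis using l that[of l] by (simp add: algebra_simps)
      qed
    qed
    define \<mu> where "\<mu> = - (\<kappa> + 1)"
    show ?thesis
    proof (cases "\<kappa> = \<mu>")
      case False
      define i where "i = inverse ((\<kappa> - \<mu>) * \<delta>)"
      have i: "i * ((\<kappa> - \<mu>) * \<delta>) = 1"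
        unfolding i_def by (rule left_inverse) (use False \<delta> in simp)
      have "scaled_conjugate a b c d \<kappa> 0 0 \<mu>"
        unfolding scaled_conjugate_def
      proof (intro exI conjI)
        show "(1::'k) \<noteq> 0" by simp
        show "i * (w1 - \<mu> * v1) * (w2 - \<kappa> * v2) - i * (w2 - \<mu> * v2) * (w1 - \<kappa> * v1) = 1"
          using i unfolding \<delta>_def by algebra
      qed (insert cayley w root, unfold \<mu>_def, algebra+)
      then show ?thesis using nz unfolding \<mu>_def by blast
    next
      case True
      then have "2 * \<kappa> = - 1" unfolding \<mu>_def by algebra
      then have half: "\<kappa> = - (1/2)" using two by (simp add: field_simps)
      obtain s where s: "s * s = - \<delta>"
        using nth_root_exists[of 2 "- \<delta>"] by (auto simp: power2_eq_square)
      define i where "i = inverse s"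
      have i: "i * i * \<delta> = - 1"
      proof -
        have "s \<noteq> 0" using s \<delta> by auto
        then have "i * s = 1" by (simp add: i_def)
        then show ?thesis using s by algebra
      qed
      have "scaled_conjugate a b c d \<kappa> 0 1 \<kappa>"
        unfolding scaled_conjugate_def
      proof (intro exI conjI)
        show "(1::'k) \<noteq> 0" by simp
        show "i * (w1 - \<kappa> * v1) * (i * v2) - i * (w2 - \<kappa> * v2) * (i * v1) = 1"
          using i unfolding \<delta>_def by algebra
      qed (insert cayley w root \<open>2 * \<kappa> = - 1\<close>, algebra+)
      then show ?thesis unfolding half by blast
    qed
  qed
qed

text \<open>For a cyclic vector \<open>v\<close> the pair \<open>v, v N\<close> is a Jordan basis, since \<open>N\<^sup>2 = 0\<close>. The rescaling of
  \<open>z\<close> makes its determinant one, so that no square root is needed.\<close>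

lemma scaled_conjugate_nilpotent:
  fixes a b c d :: "'k::field"
  assumes tr: "a + d = 0" and det: "a * d - b * c = 0" and nz: "\<not> (a = 0 \<and> b = 0 \<and> c = 0 \<and> d = 0)"
  shows "scaled_conjugate a b c d 0 1 0 0"
proof -
  have bc: "b \<noteq> 0 \<or> c \<noteq> 0"
    using assms by (auto simp: add_eq_0_iff)
  then obtain v1 v2 where cyc: "v1 * (v1 * b + v2 * d) - v2 * (v1 * a + v2 * c) \<noteq> 0"
    using cyclic_vector_exists[of b c d a] by auto
  define w1 w2 where w: "w1 = v1 * a + v2 * c" "w2 = v1 * b + v2 * d"
  define k where "k = inverse (v1 * w2 - v2 * w1)"
  have k: "k \<noteq> 0" "k * (v1 * w2 - v2 * w1) = 1" using cyc by (simp_all add: k_def w)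
  show ?thesis
    unfolding scaled_conjugate_def
  proof (intro exI conjI)
    show "k \<noteq> 0" by (rule k)
    show "v1 * (k * w2) - v2 * (k * w1) = 1" using k(2) by algebra
  qed (insert w tr det, algebra+)
qed

section \<open>Normal forms of the brackets\<close>

text \<open>Only multiples of \<open>z\<close> are added to \<open>x\<close> and \<open>y\<close>. The multiple in \<open>x\<close> is chosen to remove the
  \<open>z\<close>-component of \<open>[x,z]\<close>, and the multiple in \<open>y\<close> to remove the \<open>x\<close>-component of \<open>[x,y]\<close>; both
  divide by \<open>\<alpha>\<close> only, so that \<open>\<alpha> = -1\<close>, where the matrix is singular, is covered. The Jacobi identity
  makes the other unwanted components vanish at the same time.\<close>

lemma isomorphic_alg_C:
  fixes p q r :: "'k::field ^ 3"
  assumes char: "CHAR('k) \<noteq> 2" and T: "omega_lie_algebra (table_algebra p q r)"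
    and N: "q $ 1 = \<alpha>" "q $ 2 = 0" "r $ 1 = 0" "r $ 2 = - (\<alpha> + 1)" and "\<alpha> \<noteq> 0"
  shows "table_algebra p q r \<cong>\<^sub>\<omega> alg_C \<alpha>"
proof -
  define u where "u = inverse \<alpha>"
  have u: "u * \<alpha> = 1" using \<open>\<alpha> \<noteq> 0\<close> by (simp add: u_def)
  define x y :: "'k ^ 3" where "x = vector [1, 0, u * q $ 3]" and "y = vector [0, 1, - u * p $ 1]"
  note vec = vec_eq_iff forall_3 brk_table_nth x_def y_def N axis_def
  show ?thesis
    unfolding alg_C_def
  proof (rule table_algebra_change_basis[OF char T, of x y ez])
    have *: "p $ 1 - (u * p $ 1) * \<alpha> = 0" "p $ 2 + u * q $ 3 * (\<alpha> + 1) = 0"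
      "p $ 3 - u * p $ 1 * q $ 3 - u * q $ 3 * r $ 3 = 1" "r $ 3 = \<alpha> * (u * p $ 1) + u * p $ 1"
      using table_algebra_jacobi[OF T, unfolded N] u by algebra+
    show "brk (table_algebra p q r) x y = ez $ 1 *s x + ez $ 2 *s y + ez $ 3 *s ez"
      using *(1-3) by (simp add: vec) algebra
    show "brk (table_algebra p q r) x ez
        = (\<alpha> *s ex) $ 1 *s x + (\<alpha> *s ex) $ 2 *s y + (\<alpha> *s ex) $ 3 *s ez"
      using u by (simp add: vec) algebra
    show "brk (table_algebra p q r) y ez = (- (\<alpha> + 1) *s ey) $ 1 *s x
        + (- (\<alpha> + 1) *s ey) $ 2 *s y + (- (\<alpha> + 1) *s ey) $ 3 *s ez"
      using *(4) by (simp add: vec)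
  qed (simp_all add: x_def y_def axis_def)
qed

text \<open>The eigenvalue \<open>-1/2\<close> is nonzero, so suitable multiples of \<open>z\<close> added to \<open>x\<close> and then to \<open>y\<close> remove
  the \<open>z\<close>-components of \<open>[x,z]\<close> and \<open>[y,z]\<close>. By the Jacobi identity \<open>[x,y]\<close> is then \<open>z\<close>.\<close>

lemma isomorphic_alg_B:
  fixes p q r :: "'k::field ^ 3"
  assumes char: "CHAR('k) \<noteq> 2" and T: "omega_lie_algebra (table_algebra p q r)"
    and N: "q $ 1 = - (1/2)" "q $ 2 = 0" "r $ 1 = 1" "r $ 2 = - (1/2)"
  shows "table_algebra p q r \<cong>\<^sub>\<omega> alg_B"
proof -
  define h :: 'k where "h = 1/2"
  have h: "2 * h = 1" using two_neq_zero[OF char] by (simp add: h_def)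
  note N = N[folded h_def]
  define x y :: "'k ^ 3"
    where "x = vector [1, 0, - 2 * q $ 3]" and "y = vector [0, 1, - 2 * r $ 3 - 4 * q $ 3]"
  note vec = vec_eq_iff forall_3 brk_table_nth x_def y_def N axis_def
  show ?thesis
    unfolding alg_B_def h_def[symmetric]
  proof (rule table_algebra_change_basis[OF char T, of x y ez])
    have *: "p $ 1 - (- 2 * r $ 3 - 4 * q $ 3) * h + 2 * q $ 3 = 0" "p $ 2 - q $ 3 = 0"
      "p $ 3 + (- 2 * r $ 3 - 4 * q $ 3) * q $ 3 + 2 * q $ 3 * r $ 3 = 1"
      using table_algebra_jacobi[OF T, unfolded N] h by algebra+
    show "brk (table_algebra p q r) x y = ez $ 1 *s x + ez $ 2 *s y + ez $ 3 *s ez"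
      using * h by (simp add: vec)
    show "brk (table_algebra p q r) x ez
        = (- h *s ex) $ 1 *s x + (- h *s ex) $ 2 *s y + (- h *s ex) $ 3 *s ez"
      using h by (simp add: vec algebra_simps)
    show "brk (table_algebra p q r) y ez = (ex - h *s ey) $ 1 *s x
        + (ex - h *s ey) $ 2 *s y + (ex - h *s ey) $ 3 *s ez"
      using h by (simp add: vec) algebra
  qed (simp_all add: x_def y_def axis_def)
qed

text \<open>The Jacobi identity reduces to \<open>p\<^sub>1 = r\<^sub>3\<close> and \<open>(p\<^sub>2 + q\<^sub>3) r\<^sub>3 = 1\<close>. Adding \<open>q\<^sub>3 z\<close> to \<open>y\<close> removes the
  \<open>z\<close>-component of \<open>[x,z]\<close>. Adding \<open>a z\<close> to \<open>x\<close> lowers the \<open>z\<close>-component of \<open>[x,y]\<close> by \<open>2 a r\<^sub>3\<close>,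
  so it can be removed in characteristic different from two. The factors \<open>r\<^sub>3\<close>, \<open>1 / r\<^sub>3\<close>,
  \<open>1 / r\<^sub>3\<^sup>2\<close> on \<open>x, y, z\<close> then normalise the constants.\<close>

lemma isomorphic_alg_A:
  fixes p q r :: "'k::field ^ 3"
  assumes char: "CHAR('k) \<noteq> 2" and T: "omega_lie_algebra (table_algebra p q r)"
    and N: "q $ 1 = 0" "q $ 2 = 1" "r $ 1 = 0" "r $ 2 = 0"
  shows "table_algebra p q r \<cong>\<^sub>\<omega> alg_A"
proof -
  have J: "p $ 1 = r $ 3" "(p $ 2 + q $ 3) * r $ 3 = 1"
    using table_algebra_jacobi[OF T, unfolded N] by simp_all
  define u where "u = p $ 2 + q $ 3"
  have u: "u * r $ 3 = 1" "r $ 3 * u = 1" "p $ 2 = u - q $ 3" using J(2) by (simp_all add: u_def mult.commute)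
  define t where "t = (p $ 3 - q $ 3 * p $ 2) / 2"
  have t: "t + t = p $ 3 - q $ 3 * p $ 2"
    using two_neq_zero[OF char] by (simp add: t_def flip: mult_2)
  define x y z :: "'k ^ 3"
    where "x = vector [r $ 3, 0, t]"
      and "y = vector [0, u, u * q $ 3]" and "z = vector [0, 0, u * u]"
  note vec = vec_eq_iff forall_3 brk_table_nth x_def y_def z_def N axis_def
  show ?thesis
    unfolding alg_A_def
  proof (rule table_algebra_change_basis[OF char T, of x y z])
    have "p $ 3 + r $ 3 * (u * q $ 3) * q $ 3 - t * u * r $ 3 = t + u * q $ 3"
      using t u by algebra
    moreover have "r $ 3 * u * (u - q $ 3) + r $ 3 * (u * q $ 3) = u"
      using u(1) by algebra
    ultimately show "brk (table_algebra p q r) x y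
        = (ex + ey) $ 1 *s x + (ex + ey) $ 2 *s y + (ex + ey) $ 3 *s z"
      using u J(1) by (simp add: vec)
    show "brk (table_algebra p q r) x z = ey $ 1 *s x + ey $ 2 *s y + ey $ 3 *s z"
      using u by (simp add: vec)
    show "brk (table_algebra p q r) y z = ez $ 1 *s x + ez $ 2 *s y + ez $ 3 *s z"
      using u by (simp add: vec)
  qed (use u in \<open>auto simp: x_def y_def z_def mult.commute\<close>)
qed

text \<open>Here \<open>[u,z] = f(u) z\<close> for the linear form with \<open>f(x) = q\<^sub>3\<close> and \<open>f(y) = r\<^sub>3\<close>, and the Jacobi
  identity says \<open>f([x,y]) = 1\<close>. The new \<open>x\<close> is chosen in the kernel of \<open>f\<close>, and the new \<open>y\<close> is
  \<open>p = [x,y]\<close> itself.\<close>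

lemma isomorphic_alg_D:
  fixes p q r :: "'k::field ^ 3"
  assumes char: "CHAR('k) \<noteq> 2" and T: "omega_lie_algebra (table_algebra p q r)"
    and N: "q $ 1 = 0" "q $ 2 = 0" "r $ 1 = 0" "r $ 2 = 0"
  shows "table_algebra p q r \<cong>\<^sub>\<omega> alg_D"
proof -
  have J: "p $ 1 * q $ 3 + p $ 2 * r $ 3 = 1"
    using table_algebra_jacobi(3)[OF T, unfolded N] by (simp add: algebra_simps)
  define x :: "'k ^ 3" where "x = vector [r $ 3, - q $ 3, 0]"
  note vec = vec_eq_iff forall_3 brk_table_nth x_def N axis_def
  show ?thesis
    unfolding alg_D_def
  proof (rule table_algebra_change_basis[OF char T, of x p ez])
    show "brk (table_algebra p q r) x p = ey $ 1 *s x + ey $ 2 *s p + ey $ 3 *s ez"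
      using J by (simp add: vec) algebra
    show "brk (table_algebra p q r) x ez
        = (0 :: 'k ^ 3) $ 1 *s x + (0 :: 'k ^ 3) $ 2 *s p + (0 :: 'k ^ 3) $ 3 *s ez"
      by (simp add: vec)
    show "brk (table_algebra p q r) p ez = ez $ 1 *s x + ez $ 2 *s p + ez $ 3 *s ez"
      using J by (simp add: vec)
  qed (use J in \<open>simp_all add: x_def axis_def algebra_simps\<close>)
qed

lemma table_algebra_classification:
  fixes p q r :: "'k::alg_closed_field ^ 3"
  assumes char: "CHAR('k) \<noteq> 2" and T: "omega_lie_algebra (table_algebra p q r)"
  shows "table_algebra p q r \<cong>\<^sub>\<omega> (alg_A :: ('k, 'k ^ 3) omega_algebra) \<or>
    table_algebra p q r \<cong>\<^sub>\<omega> (alg_B :: ('k, 'k ^ 3) omega_algebra) \<or>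
    (\<exists>\<alpha>::'k. \<alpha> \<noteq> 0 \<and> table_algebra p q r \<cong>\<^sub>\<omega> alg_C \<alpha>) \<or>
    table_algebra p q r \<cong>\<^sub>\<omega> (alg_D :: ('k, 'k ^ 3) omega_algebra)"
proof -
  let ?conj = "scaled_conjugate (q $ 1) (q $ 2) (r $ 1) (r $ 2)"
  have reduce: "table_algebra p q r \<cong>\<^sub>\<omega> M"
    if conj: "?conj a b c d"
      and M: "\<And>p' q' r' :: 'k ^ 3. omega_lie_algebra (table_algebra p' q' r') \<Longrightarrow>
        q' $ 1 = a \<Longrightarrow> q' $ 2 = b \<Longrightarrow> r' $ 1 = c \<Longrightarrow> r' $ 2 = d \<Longrightarrow> table_algebra p' q' r' \<cong>\<^sub>\<omega> M"
    for a b c d and M :: "('k, 'k ^ 3) omega_algebra"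
  proof -
    obtain p' q' r' :: "'k ^ 3" where *: "table_algebra p q r \<cong>\<^sub>\<omega> table_algebra p' q' r'"
      "q' $ 1 = a" "q' $ 2 = b" "r' $ 1 = c" "r' $ 2 = d"
      using scaled_conjugate_imp_isomorphic[OF char T conj] by blast
    show ?thesis
      using omega_isomorphic_trans[OF *(1) M[OF omega_lie_isomorphic_table_algebra[OF T *(1)] *(2-5)]] .
  qed
  show ?thesis
  proof (cases "q $ 1 + r $ 2 = 0")
    case True
    \<comment> \<open>Trace zero turns the Jacobi identity into a nonzero linear relation between the rows of \<open>N\<close>.\<close>
    have "q $ 1 * r $ 2 - q $ 2 * r $ 1 = 0"
      using table_algebra_jacobi[OF T] True by algebra
    then consider "q $ 1 = 0" "q $ 2 = 0" "r $ 1 = 0" "r $ 2 = 0" | "?conj 0 1 0 0"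
      using scaled_conjugate_nilpotent[OF True] by blast
    then show ?thesis
    proof cases
      case 1
      then show ?thesis using isomorphic_alg_D[OF char T] by blast
    next
      case 2
      then show ?thesis using reduce[OF 2 isomorphic_alg_A[OF char]] by blast
    qed
  next
    case False
    define k where "k = - inverse (q $ 1 + r $ 2)"
    have "k * (q $ 1 + r $ 2) = - 1" using False by (simp add: k_def)
    then have k: "k \<noteq> 0" "k * q $ 1 + k * r $ 2 = - 1" by (auto simp: distrib_left)
    from scaled_conjugate_trace_minus_one[OF char k(2), of "k * q $ 2" "k * r $ 1"] k(1)
    consider \<alpha> where "\<alpha> \<noteq> 0" "?conj \<alpha> 0 0 (- (\<alpha> + 1))" | "?conj (- (1/2)) 0 1 (- (1/2))"
      by (blast dest: scaled_conjugate_scale)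
    then show ?thesis
    proof cases
      case 1
      then show ?thesis using reduce[OF 1(2) isomorphic_alg_C[OF char _ _ _ _ _ 1(1)]] by blast
    next
      case 2
      then show ?thesis using reduce[OF 2 isomorphic_alg_B[OF char]] by blast
    qed
  qed
qed

section \<open>Distinguishing the normal forms\<close>

lemma isomorphic_imp_trace_eq_0_iff:
  fixes q r q' r' p p' :: "'k::field ^ 3"
  assumes "table_algebra p q r \<cong>\<^sub>\<omega> table_algebra p' q' r'"
  shows "q $ 1 + r $ 2 = 0 \<longleftrightarrow> q' $ 1 + r' $ 2 = 0"
  using scaled_conjugate_invariants(1)[OF isomorphic_imp_scaled_conjugate[OF assms]] by auto

text \<open>Traces are multiplied by the scalar factor, so equal nonzero traces force that factor to be one
  and the determinants agree.\<close>

lemma isomorphic_imp_det_eq: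
  fixes q r q' r' p p' :: "'k::field ^ 3"
  assumes iso: "table_algebra p q r \<cong>\<^sub>\<omega> table_algebra p' q' r'"
    and "q $ 1 + r $ 2 = - 1" "q' $ 1 + r' $ 2 = - 1"
  shows "q $ 1 * r $ 2 - q $ 2 * r $ 1 = q' $ 1 * r' $ 2 - q' $ 2 * r' $ 1"
proof -
  obtain k where k: "- 1 = k * (- 1)"
      "q $ 1 * r $ 2 - q $ 2 * r $ 1 = k\<^sup>2 * (q' $ 1 * r' $ 2 - q' $ 2 * r' $ 1)"
    using scaled_conjugate_invariants(1)[OF isomorphic_imp_scaled_conjugate[OF iso]] assms(2,3)
    by auto
  then have "k = 1" by simp
  then show ?thesis using k(2) by simp
qed

lemma isomorphic_imp_off_diagonal_eq_0:
  fixes q r q' r' p p' :: "'k::field ^ 3"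
  assumes "table_algebra p q r \<cong>\<^sub>\<omega> table_algebra p' q' r'"
    and "q' $ 1 = r' $ 2" "q' $ 2 = 0" "r' $ 1 = 0"
  shows "q $ 2 = 0" "r $ 1 = 0"
  using scaled_conjugate_invariants(2)[OF isomorphic_imp_scaled_conjugate[OF assms(1)]] assms(2-4)
  by auto

text \<open>All these pairs except \<open>B\<close> and \<open>C\<^sub>\<alpha>\<close> differ in whether the trace vanishes or in whether \<open>N\<close> is zero.
  For the exceptional pair the determinants force \<open>(\<alpha> + 1/2)\<^sup>2 = 0\<close>, and the matrix of
  \<open>C\<^sub>\<alpha>\<close> is then scalar, unlike that of \<open>B\<close>.\<close>

lemma models_not_isomorphic:
  assumes "CHAR('k::field) \<noteq> 2"
  shows "\<not> (alg_A :: ('k, 'k ^ 3) omega_algebra) \<cong>\<^sub>\<omega> (alg_B :: ('k, 'k ^ 3) omega_algebra)"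
    and "\<not> (alg_A :: ('k, 'k ^ 3) omega_algebra) \<cong>\<^sub>\<omega> alg_C \<alpha>"
    and "\<not> (alg_A :: ('k, 'k ^ 3) omega_algebra) \<cong>\<^sub>\<omega> (alg_D :: ('k, 'k ^ 3) omega_algebra)"
    and "\<not> (alg_B :: ('k, 'k ^ 3) omega_algebra) \<cong>\<^sub>\<omega> alg_C \<alpha>"
    and "\<not> (alg_B :: ('k, 'k ^ 3) omega_algebra) \<cong>\<^sub>\<omega> (alg_D :: ('k, 'k ^ 3) omega_algebra)"
    and "\<not> alg_C \<alpha> \<cong>\<^sub>\<omega> (alg_D :: ('k, 'k ^ 3) omega_algebra)"
proof -
  have half: "1/2 + 1/2 = (1 :: 'k)" using two_neq_zero[OF assms] by (simp flip: mult_2)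
  have "- (1/2) - 1/2 = (- (1/2 + 1/2) :: 'k)" by simp
  with half have half': "- (1/2) - 1/2 = (- 1 :: 'k)" by simp
  show "\<not> (alg_A :: ('k, 'k ^ 3) omega_algebra) \<cong>\<^sub>\<omega> (alg_B :: ('k, 'k ^ 3) omega_algebra)"
  proof
    assume "(alg_A :: ('k, 'k ^ 3) omega_algebra) \<cong>\<^sub>\<omega> (alg_B :: ('k, 'k ^ 3) omega_algebra)"
    from isomorphic_imp_trace_eq_0_iff[OF this[unfolded alg_A_def alg_B_def]] show False
      using half' by (simp add: axis_def)
  qed
  show "\<not> (alg_A :: ('k, 'k ^ 3) omega_algebra) \<cong>\<^sub>\<omega> alg_C \<alpha>"
  proof
    assume "(alg_A :: ('k, 'k ^ 3) omega_algebra) \<cong>\<^sub>\<omega> alg_C \<alpha>"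
    from isomorphic_imp_trace_eq_0_iff[OF this[unfolded alg_A_def alg_C_def]] show False
      by (simp add: axis_def)
  qed
  show "\<not> (alg_A :: ('k, 'k ^ 3) omega_algebra) \<cong>\<^sub>\<omega> (alg_D :: ('k, 'k ^ 3) omega_algebra)"
  proof
    assume "(alg_A :: ('k, 'k ^ 3) omega_algebra) \<cong>\<^sub>\<omega> (alg_D :: ('k, 'k ^ 3) omega_algebra)"
    from isomorphic_imp_off_diagonal_eq_0(1)[OF this[unfolded alg_A_def alg_D_def]] show False
      by (simp add: axis_def)
  qed
  show "\<not> (alg_B :: ('k, 'k ^ 3) omega_algebra) \<cong>\<^sub>\<omega> alg_C \<alpha>"
  proof
    assume "(alg_B :: ('k, 'k ^ 3) omega_algebra) \<cong>\<^sub>\<omega> alg_C \<alpha>"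
    note iso = this[unfolded alg_B_def alg_C_def]
    define h :: 'k where "h = 1/2"
    have h: "h + h = 1" using half by (simp only: h_def)
    have "h * h = \<alpha> * (- \<alpha> - 1)"
      using isomorphic_imp_det_eq[OF iso] half' by (simp add: axis_def flip: h_def)
    then have "(\<alpha> + h) * (\<alpha> + h) = 0" using h by algebra
    then have "\<alpha> + h = 0" by simp
    then have "\<alpha> = - (\<alpha> + 1)" using h by algebra
    then show False using isomorphic_imp_off_diagonal_eq_0(2)[OF iso] by (simp add: axis_def)
  qed
  show "\<not> (alg_B :: ('k, 'k ^ 3) omega_algebra) \<cong>\<^sub>\<omega> (alg_D :: ('k, 'k ^ 3) omega_algebra)"
  proof
    assume "(alg_B :: ('k, 'k ^ 3) omega_algebra) \<cong>\<^sub>\<omega> (alg_D :: ('k, 'k ^ 3) omega_algebra)"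
    from isomorphic_imp_off_diagonal_eq_0(2)[OF this[unfolded alg_B_def alg_D_def]] show False
      by (simp add: axis_def)
  qed
  show "\<not> alg_C \<alpha> \<cong>\<^sub>\<omega> (alg_D :: ('k, 'k ^ 3) omega_algebra)"
  proof
    assume "alg_C \<alpha> \<cong>\<^sub>\<omega> (alg_D :: ('k, 'k ^ 3) omega_algebra)"
    from isomorphic_imp_trace_eq_0_iff[OF this[unfolded alg_C_def alg_D_def]] show False
      by (simp add: axis_def)
  qed
qed

lemma alg_C_isomorphic_imp:
  fixes \<alpha> \<beta> :: "'k::field"
  assumes "alg_C \<alpha> \<cong>\<^sub>\<omega> alg_C \<beta>"
  shows "\<alpha> = \<beta> \<or> \<alpha> + \<beta> = - 1"
proof -
  have "\<alpha> * (\<alpha> + 1) = \<beta> * (\<beta> + 1)"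
    using isomorphic_imp_det_eq[OF assms[unfolded alg_C_def]] by (simp add: axis_def) algebra
  then have "(\<alpha> - \<beta>) * (\<alpha> + \<beta> - (- 1)) = 0" by algebra
  then show ?thesis by (simp only: mult_eq_0_iff right_minus_eq)
qed

theorem theorem1p3:
  fixes L :: "('k::alg_closed_field, 'v::ab_group_add) omega_algebra"
  assumes "CHAR('k) \<noteq> 2"
    and "omega_lie_algebra L"
    and "non_Lie L"
    and "omega_dim L = 3"
  shows
    "(L \<cong>\<^sub>\<omega> (alg_A :: ('k, 'k ^ 3) omega_algebra) \<or>
      L \<cong>\<^sub>\<omega> (alg_B :: ('k, 'k ^ 3) omega_algebra) \<or>
      (\<exists>\<alpha>::'k. \<alpha> \<noteq> 0 \<and> L \<cong>\<^sub>\<omega> alg_C \<alpha>) \<or>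
      L \<cong>\<^sub>\<omega> (alg_D :: ('k, 'k ^ 3) omega_algebra))
     \<and>
     (\<not> (alg_A :: ('k, 'k ^ 3) omega_algebra) \<cong>\<^sub>\<omega> (alg_B :: ('k, 'k ^ 3) omega_algebra) \<and>
      \<not> (alg_A :: ('k, 'k ^ 3) omega_algebra) \<cong>\<^sub>\<omega> (alg_D :: ('k, 'k ^ 3) omega_algebra) \<and>
      \<not> (alg_B :: ('k, 'k ^ 3) omega_algebra) \<cong>\<^sub>\<omega> (alg_D :: ('k, 'k ^ 3) omega_algebra) \<and>
      (\<forall>\<alpha>::'k. \<alpha> \<noteq> 0 \<longrightarrow>
         \<not> (alg_A :: ('k, 'k ^ 3) omega_algebra) \<cong>\<^sub>\<omega> alg_C \<alpha> \<and>
         \<not> (alg_B :: ('k, 'k ^ 3) omega_algebra) \<cong>\<^sub>\<omega> alg_C \<alpha> \<and>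
         \<not> alg_C \<alpha> \<cong>\<^sub>\<omega> (alg_D :: ('k, 'k ^ 3) omega_algebra)) \<and>
      (\<forall>\<alpha> \<beta>::'k. \<alpha> \<noteq> 0 \<longrightarrow> \<beta> \<noteq> 0 \<longrightarrow> \<alpha> \<noteq> \<beta> \<longrightarrow> \<alpha> + \<beta> \<noteq> -1 \<longrightarrow>
         \<not> alg_C \<alpha> \<cong>\<^sub>\<omega> alg_C \<beta>))"
proof (intro conjI allI impI)
  obtain p q r :: "'k ^ 3" where iso: "L \<cong>\<^sub>\<omega> table_algebra p q r"
    using exists_isomorphic_table_algebra[OF assms] by (elim exE)
  show "L \<cong>\<^sub>\<omega> (alg_A :: ('k, 'k ^ 3) omega_algebra) \<or>
      L \<cong>\<^sub>\<omega> (alg_B :: ('k, 'k ^ 3) omega_algebra) \<or>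
      (\<exists>\<alpha>::'k. \<alpha> \<noteq> 0 \<and> L \<cong>\<^sub>\<omega> alg_C \<alpha>) \<or>
      L \<cong>\<^sub>\<omega> (alg_D :: ('k, 'k ^ 3) omega_algebra)"
    using table_algebra_classification[OF assms(1)
        omega_lie_isomorphic_table_algebra[OF assms(2) iso]]
    by (elim disjE exE) (use omega_isomorphic_trans[OF iso] in auto)
next
  fix \<alpha> \<beta> :: 'k
  assume "\<alpha> \<noteq> \<beta>" "\<alpha> + \<beta> \<noteq> - 1"
  then show "\<not> alg_C \<alpha> \<cong>\<^sub>\<omega> alg_C \<beta>" using alg_C_isomorphic_imp by blast
qed (rule models_not_isomorphic[OF assms(1)])+

end
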